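(* Let $\mu$ be a probability measure on the real line with (finite) variance $\sigma^2$ and mean zero, and let $F$ be its reciprocal Cauchy transform. Then $F$ is univalent in $\mathbb H$ if and only if there is a chordal Loewner family $\{f(t;\cdot),\ t\in[0,\infty)\}$ such that $F(z)=f(\sigma^2;z)$ for all $z\in\mathbb H$.
   Context: $\mathbb H=\{z\in\mathbb C:\Im(z)>0\}$. For a probability measure $\mu$ on $\mathbb R$, the Cauchy transform is $G_\mu(z)=\int_{\mathbb R}\frac{\mu(dx)}{z-x}$, $z\in\mathbb H$, and the reciprocal Cauchy transform is $F=1/G_\mu:\mathbb H\to\mathbb H$. Univalent means analytic and injective. $\mathfrak R$ denotes the class of univalent analytic functions $f:\mathbb H\to\mathbb H$ for which there is a constant $C\in[0,\infty)$ with $|f(z)-z|\le C/\Im(z)$ for all $z\in\mathbb H$. For $f\in\mathfrak R$ the limit $\lim_{y\to\infty}iy[iy-f(iy)]$ exists and equals the least such constant $C$. For $f,g\in\mathfrak R$, $f$ is subordinate to $g$, written $f\prec g$, if $f=g\circ h$ for some $h\in\mathfrak R$. This is a partial order on $\mathfrak R$. A chain is a nonempty totally ordered subset of $\mathfrak R$, and a chordal Loewner family is a maximal chain (maximal with respect to inclusion). A chordal Loewner family is written in parametrized form $\{f(t;\cdot),\ t\in[0,\infty)\}$, where $f(t;\cdot)$ is the unique element $f$ of the family with $\lim_{y\to\infty}iy[iy-f(iy)]=t$ (every $t\in[0,\infty)$ occurs exactly once). *)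

theory Defs
  imports "HOL-Probability.Probability" "HOL-Complex_Analysis.Complex_Analysis"
begin

definition upper_half_plane :: "complex set" (\<open>\<H>\<close>)
  where "\<H> = {z. Im z > 0}"

definition cauchy_transform :: "real measure \<Rightarrow> complex \<Rightarrow> complex"
  where "cauchy_transform \<mu> z = (LINT x|\<mu>. 1 / (z - complex_of_real x))"

definition reciprocal_cauchy_transform :: "real measure \<Rightarrow> complex \<Rightarrow> complex"
  where "reciprocal_cauchy_transform \<mu> z = 1 / cauchy_transform \<mu> z"

definition univalent_on :: "(complex \<Rightarrow> complex) \<Rightarrow> complex set \<Rightarrow> bool"
    (infix \<open>univalent'_on\<close> 50)
  where "f univalent_on S \<longleftrightarrow> f analytic_on S \<and> inj_on f S"

text \<open>
  Elements are taken in \<open>extensional \<H>\<close>, so that equality of elements is equality of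
  functions on the upper half-plane; otherwise subordination would only be a preorder
  and the elements of a maximal chain would not be determined by their values on \<open>\<H>\<close>.
\<close>

definition class_R :: "(complex \<Rightarrow> complex) set" (\<open>\<RR>\<close>)
  where "\<RR> = {f \<in> extensional \<H>. f univalent_on \<H> \<and> f ` \<H> \<subseteq> \<H> \<and>
    (\<exists>C\<ge>0. \<forall>z\<in>\<H>. norm (f z - z) \<le> C / Im z)}"

definition subordinate :: "(complex \<Rightarrow> complex) \<Rightarrow> (complex \<Rightarrow> complex) \<Rightarrow> bool"
    (infix \<open>\<prec>\<close> 50)
  where "f \<prec> g \<longleftrightarrow> (\<exists>h\<in>\<RR>. f = compose \<H> g h)"

definition chordal_loewner_family :: "(complex \<Rightarrow> complex) set \<Rightarrow> bool"
  where "chordal_loewner_family L \<longleftrightarrow> L \<noteq> {} \<and> pred_on.maxchain \<RR> (\<prec>) L"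

definition has_parameter :: "(complex \<Rightarrow> complex) \<Rightarrow> real \<Rightarrow> bool"
  where "has_parameter f t \<longleftrightarrow>
    ((\<lambda>y. \<i> * complex_of_real y * (\<i> * complex_of_real y - f (\<i> * complex_of_real y)))
      \<longlongrightarrow> complex_of_real t) at_top"

text \<open>
  \<open>loewner_map L t\<close> is \<open>f(t; \<cdot>)\<close>, the unique element of \<open>L\<close> with parameter \<open>t\<close>.
  In a chordal Loewner family every \<open>t \<ge> 0\<close> is the parameter of exactly one element, so there
  the second branch is void; it only makes the function total (for instance at \<open>t < 0\<close>).
\<close>

definition loewner_map :: "(complex \<Rightarrow> complex) set \<Rightarrow> real \<Rightarrow> complex \<Rightarrow> complex"
  where "loewner_map L t =
    (if \<exists>!f. f \<in> L \<and> has_parameter f t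
     then THE f. f \<in> L \<and> has_parameter f t
     else (\<lambda>z. 0))"

end

theory Submission
  imports Defs "HOL-Real_Asymp.Real_Asymp"
begin

text \<open>
  If \<open>F\<close> is univalent, it lies in \<open>\<RR>\<close> with parameter \<open>\<sigma>\<^sup>2\<close>, and Zorn's lemma extends \<open>{F}\<close> to a
  maximal chain. What has to be seen is that a chain contains only one element with a given
  parameter. If \<open>f = g \<circ> h\<close> has the same parameter as \<open>g\<close>, then \<open>h(iy) - iy = o(1/y)\<close>. The
  Schwarz-Pick inequality drives everything here: with one point escaping to \<open>i\<infinity>\<close> it gives
  \<open>Im h(z) \<ge> Im z\<close> (Julia's lemma), so that \<open>h(z) - z\<close> is a self-map of the closed upper
  half-plane; applied to \<open>g(z) - z\<close> it compares the values at \<open>iy\<close> and \<open>h(iy)\<close>; and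
  applied to \<open>h(z) - z\<close> it excludes decay faster than \<open>1/y\<close> unless \<open>h\<close> is the identity.
  Conversely, \<open>F\<close> has no zero, so it cannot be the junk value of \<open>loewner_map\<close> and is an
  element of the chain.
\<close>

section \<open>The Schwarz-Pick inequality\<close>

lemma mem_upper_half_plane [simp]: "z \<in> \<H> \<longleftrightarrow> Im z > 0"
  by (simp add: upper_half_plane_def)

lemma open_upper_half_plane: "open \<H>"
  unfolding upper_half_plane_def by (rule open_halfspace_Im_gt)

text \<open>This identity links the half-plane to the disc: it shows that
  \<open>(p - b) / (p - cnj b)\<close> has modulus below 1, and at the end it removes the conjugates
  from the Schwarz-Pick inequality.\<close>

lemma cmod_diff_cnj_sq: "(cmod (p - cnj b))\<^sup>2 = (cmod (p - b))\<^sup>2 + 4 * Im p * Im b"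
  unfolding cmod_power2 by (simp add: power2_eq_square algebra_simps)

lemma cmod_diff_less_cnj:
  assumes "Im p > 0" "Im b > 0"
  shows "cmod (p - b) < cmod (p - cnj b)"
proof (rule power2_less_imp_less)
  show "(cmod (p - b))\<^sup>2 < (cmod (p - cnj b))\<^sup>2"
    unfolding cmod_diff_cnj_sq using assms by simp
qed simp

text \<open>Cayley transforms sending \<open>a\<close> and \<open>f a\<close> to 0 turn
  \<open>f\<close> into a self-map of the unit disc fixing 0, to which the Schwarz lemma applies.
  The division-free form with squares suits the passages to the limit below.\<close>

lemma schwarz_pick_open:
  assumes hol: "f holomorphic_on \<H>" and self: "f ` \<H> \<subseteq> \<H>"
    and a: "Im a > 0" and z: "Im z > 0"
  shows "(cmod (f z - f a))\<^sup>2 * (Im z * Im a) \<le> (cmod (z - a))\<^sup>2 * (Im (f z) * Im (f a))"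
proof -
  have f_pos: "Im (f w) > 0" if "Im w > 0" for w
    using self that by (force simp: image_subset_iff)
  define b where "b = f a"
  have b: "Im b > 0" using f_pos a by (simp add: b_def)
  \<comment> \<open>The inverse of the Cayley transform
    \<open>(z - a) / (z - cnj a)\<close>.\<close>
  define \<psi> where "\<psi> w = (a - cnj a * w) / (1 - w)" for w
  have \<psi>_pos: "Im (\<psi> w) > 0" if w: "cmod w < 1" for w
  proof -
    have "w \<noteq> 1" using w by auto
    then have "\<psi> w * (1 - w) = a - cnj a * w" by (simp add: \<psi>_def)
    then have eq: "\<psi> w - a = w * (\<psi> w - cnj a)" by (simp add: algebra_simps)
    have "\<psi> w - cnj a \<noteq> 0"
    proof
      assume "\<psi> w - cnj a = 0"
      then have "a = cnj a" using eq by simp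
      then show False using a by (simp add: complex_eq_iff)
    qed
    then have "cmod (\<psi> w - a) < cmod (\<psi> w - cnj a)"
      using w by (simp add: eq norm_mult)
    then have "(cmod (\<psi> w - a))\<^sup>2 < (cmod (\<psi> w - cnj a))\<^sup>2"
      by (intro power_strict_mono) auto
    then show ?thesis using a by (simp add: cmod_diff_cnj_sq zero_less_mult_iff)
  qed
  define g where "g w = (f (\<psi> w) - b) / (f (\<psi> w) - cnj b)" for w
  have ne: "p - cnj b \<noteq> 0" if "Im p > 0" for p
    using that b by (auto simp: complex_eq_iff)
  have "g holomorphic_on ball 0 1"
  proof -
    have \<psi>_hol: "\<psi> holomorphic_on ball 0 1"
      unfolding \<psi>_def by (intro holomorphic_intros) auto
    have "(f \<circ> \<psi>) holomorphic_on ball 0 1"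
      by (rule holomorphic_on_compose_gen[OF \<psi>_hol hol]) (auto simp: \<psi>_pos)
    then have "(\<lambda>w. f (\<psi> w)) holomorphic_on ball 0 1" by (simp add: o_def)
    then show ?thesis
      unfolding g_def using ne f_pos \<psi>_pos by (intro holomorphic_intros) auto
  qed
  moreover have "g 0 = 0" by (simp add: g_def \<psi>_def b_def)
  moreover have "cmod (g w) < 1" if "cmod w < 1" for w
    using cmod_diff_less_cnj[OF f_pos[OF \<psi>_pos[OF that]] b] ne[OF f_pos[OF \<psi>_pos[OF that]]]
    by (simp add: g_def norm_divide divide_simps)
  moreover define \<xi> where "\<xi> = (z - a) / (z - cnj a)"
  have za: "z - cnj a \<noteq> 0" using a z by (auto simp: complex_eq_iff)
  have "cmod \<xi> < 1"
    using cmod_diff_less_cnj[OF z a] za by (simp add: \<xi>_def norm_divide divide_simps)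
  ultimately have "cmod (g \<xi>) \<le> cmod \<xi>" by (intro Schwarz_Lemma(1))
  moreover have "\<psi> \<xi> = z"
  proof -
    have "a - cnj a \<noteq> 0" using a by (auto simp: complex_eq_iff)
    moreover have "1 - \<xi> = (a - cnj a) / (z - cnj a)"
      using za by (simp add: \<xi>_def field_simps)
    moreover have "a - cnj a * \<xi> = z * ((a - cnj a) / (z - cnj a))"
      using za by (simp add: \<xi>_def field_simps)
    ultimately show ?thesis using za by (simp add: \<psi>_def)
  qed
  ultimately have "cmod (f z - b) * cmod (z - cnj a) \<le> cmod (z - a) * cmod (f z - cnj b)"
    using ne[OF f_pos[OF z]] za by (simp add: g_def \<xi>_def norm_divide divide_simps mult.commute)
  then have "(cmod (f z - b) * cmod (z - cnj a))\<^sup>2 \<le> (cmod (z - a) * cmod (f z - cnj b))\<^sup>2"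
    by (intro power_mono) auto
  \<comment> \<open>After expansion of both conjugate distances, the product of
    \<open>(cmod (f z - b))\<^sup>2\<close> and \<open>(cmod (z - a))\<^sup>2\<close> cancels, and a
    common factor 4 remains.\<close>
  then show ?thesis
    unfolding power_mult_distrib cmod_diff_cnj_sq b_def by (simp add: algebra_simps)
qed

text \<open>Adding \<open>\<i> * e\<close> with \<open>e > 0\<close> reduces this to the open case;
  then \<open>e\<close> tends to 0. The closed half-plane is the right target for maps such as
  \<open>h z - z\<close>, whose imaginary part may vanish.\<close>

lemma schwarz_pick:
  assumes hol: "f holomorphic_on \<H>" and nonneg: "\<And>w. Im w > 0 \<Longrightarrow> Im (f w) \<ge> 0"
    and a: "Im a > 0" and z: "Im z > 0"
  shows "(cmod (f z - f a))\<^sup>2 * (Im z * Im a) \<le> (cmod (z - a))\<^sup>2 * (Im (f z) * Im (f a))"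
proof (rule tendsto_lowerbound)
  have "((\<lambda>e::real. (cmod (z - a))\<^sup>2 * ((Im (f z) + e) * (Im (f a) + e)))
      \<longlongrightarrow> (cmod (z - a))\<^sup>2 * ((Im (f z) + 0) * (Im (f a) + 0))) (at_right 0)"
    by (intro tendsto_intros)
  then show "((\<lambda>e::real. (cmod (z - a))\<^sup>2 * ((Im (f z) + e) * (Im (f a) + e)))
      \<longlongrightarrow> (cmod (z - a))\<^sup>2 * (Im (f z) * Im (f a))) (at_right 0)"
    by simp
  show "\<forall>\<^sub>F e in at_right 0. (cmod (f z - f a))\<^sup>2 * (Im z * Im a)
      \<le> (cmod (z - a))\<^sup>2 * ((Im (f z) + e) * (Im (f a) + e))"
    using eventually_at_right_less[of "0::real"]
  proof eventually_elim
    case (elim e)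
    have "(\<lambda>w. f w + \<i> * of_real e) holomorphic_on \<H>"
      using hol by (intro holomorphic_intros)
    moreover have "(\<lambda>w. f w + \<i> * of_real e) ` \<H> \<subseteq> \<H>"
      using nonneg elim by (auto simp: add_nonneg_pos)
    ultimately show ?case
      using schwarz_pick_open[of "\<lambda>w. f w + \<i> * of_real e" a z] a z by simp
  qed
qed simp

section \<open>The class of maps close to the identity\<close>

lemma tendsto_of_real_inverse_at_top: "((\<lambda>y::real. complex_of_real (1 / y)) \<longlongrightarrow> 0) at_top"
proof -
  have "((\<lambda>y::real. 1 / y) \<longlongrightarrow> 0) at_top" by real_asymp
  from tendsto_of_real[OF this] show ?thesis by (simp only: of_real_0)
qed

lemma class_R_D:
  assumes "f \<in> \<RR>"
  shows "f \<in> extensional \<H>" "f holomorphic_on \<H>" "inj_on f \<H>"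
    "\<And>z. Im z > 0 \<Longrightarrow> Im (f z) > 0"
  using assms open_upper_half_plane
  by (force simp: class_R_def univalent_on_def analytic_on_open image_subset_iff)+

lemma class_R_bound:
  assumes "f \<in> \<RR>"
  obtains C where "C \<ge> 0" "\<And>z. Im z > 0 \<Longrightarrow> cmod (f z - z) \<le> C / Im z"
  using assms by (auto simp: class_R_def)

lemma class_R_diff_tendsto_0:
  assumes "f \<in> \<RR>"
  shows "((\<lambda>y. f (\<i> * of_real y) - \<i> * of_real y) \<longlongrightarrow> 0) at_top"
proof -
  obtain C where C: "\<And>z. Im z > 0 \<Longrightarrow> cmod (f z - z) \<le> C / Im z"
    using class_R_bound[OF assms] by blast
  have "((\<lambda>y::real. C / y) \<longlongrightarrow> 0) at_top" by real_asymp
  moreover have "\<forall>\<^sub>F y in at_top. cmod (f (\<i> * of_real y) - \<i> * of_real y) \<le> C / y"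
    using eventually_gt_at_top[of 0] 
  proof eventually_elim
    case (elim y)
    then show ?case using C[of "\<i> * of_real y"] by simp
  qed
  ultimately show ?thesis by (rule Lim_null_comparison[rotated])
qed

text \<open>Julia's lemma at infinity: Schwarz-Pick for \<open>z\<close> and
  \<open>\<i> * y\<close>, with \<open>y\<close> tending to infinity.\<close>

lemma class_R_Im_ge:
  assumes "h \<in> \<RR>" and z: "Im z > 0"
  shows "Im (h z) \<ge> Im z"
proof -
  note hD = class_R_D[OF \<open>h \<in> \<RR>\<close>]
  define d where "d y = h (\<i> * of_real y) - \<i> * of_real y" for y :: real
  have d: "(d \<longlongrightarrow> 0) at_top"
    unfolding d_def by (rule class_R_diff_tendsto_0[OF \<open>h \<in> \<RR>\<close>])
  note inv = tendsto_of_real_inverse_at_top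
  have inv': "((\<lambda>y::real. 1 / y) \<longlongrightarrow> 0) at_top" by real_asymp
  \<comment> \<open>\<open>?L\<close> and \<open>?R\<close> are the two sides of Schwarz-Pick
    divided by \<open>y ^ 3\<close> and written in terms of \<open>1 / y\<close>, so that the limits
    \<open>Im z\<close> and \<open>Im (h z)\<close> can be read off.\<close>
  let ?L = "\<lambda>y::real. (cmod ((h z - d y) * of_real (1 / y) - \<i>))\<^sup>2 * Im z"
  let ?R = "\<lambda>y::real. (cmod (z * of_real (1 / y) - \<i>))\<^sup>2 * (Im (h z) * (1 + Im (d y) * (1 / y)))"
  have "(?L \<longlongrightarrow> (cmod ((h z - 0) * 0 - \<i>))\<^sup>2 * Im z) at_top"
    by (intro tendsto_intros d inv)
  moreover have "(?R \<longlongrightarrow> (cmod (z * 0 - \<i>))\<^sup>2 * (Im (h z) * (1 + Im 0 * 0))) at_top"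
    by (intro tendsto_intros d inv inv')
  moreover have "\<forall>\<^sub>F y in at_top. ?L y \<le> ?R y"
    using eventually_gt_at_top[of 0]
  proof eventually_elim
    case (elim y)
    have "(cmod (h z - h (\<i> * of_real y)))\<^sup>2 * (Im z * y)
        \<le> (cmod (z - \<i> * of_real y))\<^sup>2 * (Im (h z) * Im (h (\<i> * of_real y)))"
      using schwarz_pick[OF hD(2), of "\<i> * of_real y" z] hD(4) elim z by (simp add: less_imp_le)
    moreover have "h (\<i> * of_real y) = \<i> * of_real y + d y" by (simp add: d_def)
    moreover have "h z - (\<i> * of_real y + d y) = of_real y * ((h z - d y) * of_real (1 / y) - \<i>)"
      "z - \<i> * of_real y = of_real y * (z * of_real (1 / y) - \<i>)"
      "Im (\<i> * of_real y + d y) = y * (1 + Im (d y) * (1 / y))"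
      using elim by (simp_all add: field_simps)
    ultimately have "y ^ 3 * ?L y \<le> y ^ 3 * ?R y"
      by (simp only: norm_mult norm_of_real power_mult_distrib power2_abs)
         (simp add: power3_eq_cube power2_eq_square mult_ac)
    then show ?case using elim by simp
  qed
  ultimately have "(cmod ((h z - 0) * 0 - \<i>))\<^sup>2 * Im z
      \<le> (cmod (z * 0 - \<i>))\<^sup>2 * (Im (h z) * (1 + Im 0 * 0))"
    by (intro tendsto_le[where F = "at_top :: real filter" and f = ?R and g = ?L]) auto
  then show ?thesis by simp
qed

text \<open>Replacing \<open>h(iy)\<close> by \<open>iy\<close> inside \<open>g(w) - w\<close> costs
  only \<open>O(1/y^3)\<close>, negligible against the order \<open>1/y\<close> that determines the
  parameter. Bounding the two values separately would give only \<open>O(1/y)\<close>; Schwarz-Pick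
  for \<open>g(w) - w\<close> gains a factor \<open>1/y\<close> from \<open>h(iy) - iy\<close> and
  another from the imaginary parts of the two points.\<close>

lemma class_R_comp_self_bound:
  assumes g: "g \<in> \<RR>" and h: "h \<in> \<RR>"
  obtains C where "\<And>y. y > 0 \<Longrightarrow>
    cmod ((g (h (\<i> * of_real y)) - h (\<i> * of_real y)) - (g (\<i> * of_real y) - \<i> * of_real y)) \<le> C / y ^ 3"
proof -
  obtain C where C: "C \<ge> 0" "\<And>z. Im z > 0 \<Longrightarrow> cmod (g z - z) \<le> C / Im z"
    using class_R_bound[OF g] by blast
  obtain D where D: "D \<ge> 0" "\<And>z. Im z > 0 \<Longrightarrow> cmod (h z - z) \<le> D / Im z"
    using class_R_bound[OF h] by blast
  have "cmod ((g (h (\<i> * of_real y)) - h (\<i> * of_real y)) - (g (\<i> * of_real y) - \<i> * of_real y)) \<le> (D * C) / y ^ 3"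
    if y: "y > 0" for y :: real
  proof -
    let ?k = "\<lambda>z. g z - z"
    define p where "p = \<i> * complex_of_real y"
    have p: "Im p = y" "Im p > 0" using y by (simp_all add: p_def)
    have q: "Im (h p) \<ge> y" using class_R_Im_ge[OF h p(2)] p(1) by simp
    have k_hol: "?k holomorphic_on \<H>"
      using class_R_D(2)[OF g] by (intro holomorphic_intros)
    have k_nonneg: "Im (?k w) \<ge> 0" if "Im w > 0" for w
      using class_R_Im_ge[OF g that] by simp
    have "C / Im (h p) \<le> C / y" using C(1) q y by (intro divide_left_mono) auto
    moreover have "cmod (?k (h p)) \<le> C / Im (h p)" using C(2) q y by simp
    moreover have "cmod (?k p) \<le> C / y" using C(2)[OF p(2)] p(1) by simp
    ultimately have k: "Im (?k (h p)) \<le> C / y" "Im (?k p) \<le> C / y"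
      using abs_Im_le_cmod[of "?k (h p)"] abs_Im_le_cmod[of "?k p"] by linarith+
    have "(cmod (?k (h p) - ?k p))\<^sup>2 * (y * y) \<le> (cmod (?k (h p) - ?k p))\<^sup>2 * (Im (h p) * Im p)"
      using q y p by (intro mult_left_mono mult_mono) auto
    also have "\<dots> \<le> (cmod (h p - p))\<^sup>2 * (Im (?k (h p)) * Im (?k p))"
      using q y by (intro schwarz_pick[OF k_hol k_nonneg p(2)]) auto
    also have "\<dots> \<le> (D / y)\<^sup>2 * ((C / y) * (C / y))"
      using D(2)[OF p(2)] p k k_nonneg[of "h p"] k_nonneg[OF p(2)] q y C(1)
      by (intro mult_mono power_mono) auto
    finally have "(cmod (?k (h p) - ?k p) * y)\<^sup>2 \<le> (D * C / y\<^sup>2)\<^sup>2"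
      by (simp add: power2_eq_square mult_ac)
    then have "cmod (?k (h p) - ?k p) * y \<le> D * C / y\<^sup>2"
      by (rule power2_le_imp_le) (use C D in simp)
    then show ?thesis
      using y unfolding p_def by (simp add: field_simps power3_eq_cube power2_eq_square)
  qed
  then show ?thesis by (rule that)
qed

text \<open>A rigidity statement at infinity: Schwarz-Pick for \<open>k w = h w - w\<close> at
  \<open>z\<close> and \<open>\<i> * y\<close> bounds \<open>k z\<close> by a quantity that tends to
  0.\<close>

lemma class_R_eq_ident:
  assumes h: "h \<in> \<RR>" and z: "Im z > 0"
    and lim: "((\<lambda>y. of_real y * (h (\<i> * of_real y) - \<i> * of_real y)) \<longlongrightarrow> 0) at_top"
  shows "h z = z"
proof -
  define k where "k w = h w - w" for w
  have k_hol: "k holomorphic_on \<H>"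
    unfolding k_def using class_R_D(2)[OF h] by (intro holomorphic_intros)
  have k_nonneg: "Im (k w) \<ge> 0" if "Im w > 0" for w
    using class_R_Im_ge[OF h that] by (simp add: k_def)
  have k0: "((\<lambda>y. k (\<i> * of_real y)) \<longlongrightarrow> 0) at_top"
    unfolding k_def by (rule class_R_diff_tendsto_0[OF h])
  have lim': "((\<lambda>y. of_real y * k (\<i> * of_real y)) \<longlongrightarrow> 0) at_top"
    using lim by (simp add: k_def)
  note inv = tendsto_of_real_inverse_at_top
  \<comment> \<open>Both sides are divided by \<open>y\<close>. The squared distance from
    \<open>z\<close> to \<open>\<i> * y\<close> supplies \<open>y\<^sup>2\<close>; the remaining
    power of \<open>y\<close> goes to \<open>k (\<i> * y)\<close>, where the assumed decay absorbs
    it.\<close>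
  let ?L = "\<lambda>y::real. (cmod (k z - k (\<i> * of_real y)))\<^sup>2 * Im z"
  let ?R = "\<lambda>y::real. (cmod (z * of_real (1 / y) - \<i>))\<^sup>2 * (Im (k z) * Im (of_real y * k (\<i> * of_real y)))"
  have "(?L \<longlongrightarrow> (cmod (k z - 0))\<^sup>2 * Im z) at_top"
    by (intro tendsto_intros k0)
  moreover have "(?R \<longlongrightarrow> (cmod (z * 0 - \<i>))\<^sup>2 * (Im (k z) * Im 0)) at_top"
    by (intro tendsto_intros lim' inv)
  moreover have "\<forall>\<^sub>F y in at_top. ?L y \<le> ?R y"
    using eventually_gt_at_top[of 0]
  proof eventually_elim
    case (elim y)
    have "(cmod (k z - k (\<i> * of_real y)))\<^sup>2 * (Im z * y)
        \<le> (cmod (z - \<i> * of_real y))\<^sup>2 * (Im (k z) * Im (k (\<i> * of_real y)))"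
      using schwarz_pick[OF k_hol k_nonneg, of "\<i> * of_real y" z] elim z by simp
    moreover have "z - \<i> * of_real y = of_real y * (z * of_real (1 / y) - \<i>)"
      using elim by (simp add: field_simps)
    ultimately have "y * ?L y \<le> y * ?R y"
      by (simp only: norm_mult norm_of_real power_mult_distrib power2_abs)
         (simp add: power2_eq_square mult_ac)
    then show ?case using elim by simp
  qed
  ultimately have "(cmod (k z - 0))\<^sup>2 * Im z \<le> (cmod (z * 0 - \<i>))\<^sup>2 * (Im (k z) * Im 0)"
    by (intro tendsto_le[where F = "at_top :: real filter" and f = ?R and g = ?L]) auto
  then have "(cmod (k z))\<^sup>2 \<le> 0" using z by (simp add: mult_le_0_iff)
  then show ?thesis by (simp add: k_def)
qed

text \<open>Parameters add under composition up to a vanishing error, so in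
  \<open>f = g \<circ> h\<close> equal parameters leave the parameter 0 for \<open>h\<close>, which
  forces \<open>h\<close> to be the identity on \<open>\<H>\<close>.\<close>

lemma subordinate_has_parameter_eq:
  fixes f g :: "complex \<Rightarrow> complex"
  assumes g: "g \<in> \<RR>" and sub: "f \<prec> g"
    and f_par: "has_parameter f t" and g_par: "has_parameter g t"
  shows "f = g"
proof -
  obtain h where h: "h \<in> \<RR>" and f: "f = compose \<H> g h"
    using sub by (auto simp: subordinate_def)
  \<comment> \<open>The error of additivity: \<open>f(iy) - g(iy) = (h(iy) - iy) + \<phi> y\<close>
    for \<open>y > 0\<close>.\<close>
  define \<phi> where "\<phi> y = (g (h (\<i> * of_real y)) - h (\<i> * of_real y)) - (g (\<i> * of_real y) - \<i> * of_real y)" for y :: real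
  obtain C where C: "\<And>y. y > 0 \<Longrightarrow> cmod (\<phi> y) \<le> C / y ^ 3"
    unfolding \<phi>_def using class_R_comp_self_bound[OF g h] by blast
  have "((\<lambda>y. \<i> * of_real y * \<phi> y) \<longlongrightarrow> 0) at_top"
  proof (rule Lim_null_comparison)
    show "((\<lambda>y::real. C / y\<^sup>2) \<longlongrightarrow> 0) at_top" by real_asymp
    show "\<forall>\<^sub>F y in at_top. cmod (\<i> * of_real y * \<phi> y) \<le> C / y\<^sup>2"
      using eventually_gt_at_top[of 0]
    proof eventually_elim
      case (elim y)
      then show ?case
        using C[OF elim] by (simp add: norm_mult field_simps power3_eq_cube power2_eq_square)
    qed
  qed
  from tendsto_add[OF tendsto_diff[OF g_par[unfolded has_parameter_def] f_par[unfolded has_parameter_def]]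
      tendsto_minus[OF this]]
  have "((\<lambda>y. \<i> * of_real y * (\<i> * of_real y - g (\<i> * of_real y))
      - \<i> * of_real y * (\<i> * of_real y - f (\<i> * of_real y)) + - (\<i> * of_real y * \<phi> y)) \<longlongrightarrow> 0) at_top"
    by simp
  from tendsto_mult_left[OF this, of "- \<i>"]
  have lim: "((\<lambda>y. - \<i> * (\<i> * of_real y * (\<i> * of_real y - g (\<i> * of_real y))
      - \<i> * of_real y * (\<i> * of_real y - f (\<i> * of_real y)) + - (\<i> * of_real y * \<phi> y))) \<longlongrightarrow> 0) at_top"
    by simp
  have "((\<lambda>y. of_real y * (h (\<i> * of_real y) - \<i> * of_real y)) \<longlongrightarrow> 0) at_top"
  proof (rule Lim_transform_eventually[OF lim])
    show "\<forall>\<^sub>F y in at_top. - \<i> * (\<i> * of_real y * (\<i> * of_real y - g (\<i> * of_real y))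
      - \<i> * of_real y * (\<i> * of_real y - f (\<i> * of_real y)) + - (\<i> * of_real y * \<phi> y))
      = of_real y * (h (\<i> * of_real y) - \<i> * of_real y)"
      using eventually_gt_at_top[of 0]
    proof eventually_elim
      case (elim y)
      then have "f (\<i> * of_real y) = g (h (\<i> * of_real y))"
        by (simp add: f compose_def)
      then show ?case by (simp add: \<phi>_def algebra_simps)
    qed
  qed
  then have "h z = z" if "Im z > 0" for z
    using class_R_eq_ident[OF h that] by blast
  \<comment> \<open>Outside \<open>\<H>\<close> both functions are \<open>undefined\<close>, so
    agreement on \<open>\<H>\<close> gives equality.\<close>
  then show ?thesis
    using class_R_D(1)[OF g] by (auto simp: f compose_def fun_eq_iff extensional_def)
qed

section \<open>Maximal chains\<close>

text \<open>Zorn's lemma for the chains containing \<open>X\<close>, ordered by inclusion: two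
  points of the union of a nested family already lie in a common member.\<close>

lemma (in pred_on) chain_extends_to_maxchain:
  assumes "chain X"
  obtains M where "maxchain M" "X \<subseteq> M"
proof -
  let ?\<A> = "{C. chain C \<and> X \<subseteq> C}"
  have "\<exists>M\<in>?\<A>. \<forall>C\<in>?\<A>. M \<subseteq> C \<longrightarrow> C = M"
  proof (rule subset_Zorn_nonempty)
    have "X \<in> ?\<A>" using assms by simp
    then show "?\<A> \<noteq> {}" by (metis empty_iff)
  next
    fix \<C> assume ne: "\<C> \<noteq> {}" and ch: "subset.chain ?\<A> \<C>"
    have sub: "chain C" "X \<subseteq> C" if "C \<in> \<C>" for C
      using ch that by (auto simp: subset_chain_def)
    have "x \<sqsubseteq> y \<or> y \<sqsubseteq> x" if xy: "x \<in> \<Union>\<C>" "y \<in> \<Union>\<C>" for x y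
    proof -
      obtain C D where CD: "C \<in> \<C>" "D \<in> \<C>" "x \<in> C" "y \<in> D" using xy by blast
      then have "C \<subseteq> D \<or> D \<subseteq> C" using ch by (auto simp: subset_chain_def)
      then obtain E where E: "E \<in> \<C>" "x \<in> E" "y \<in> E" using CD by blast
      from sub(1)[OF E(1)] E(2,3) show ?thesis by (simp add: chain_def)
    qed
    moreover have "\<Union>\<C> \<subseteq> A"
      using sub(1) by (auto simp: chain_def)
    moreover have "X \<subseteq> \<Union>\<C>" using sub(2) ne by blast
    ultimately show "\<Union>\<C> \<in> ?\<A>" by (simp add: chain_def)
  qed
  then obtain M where M: "chain M" "X \<subseteq> M" and max: "\<And>C. chain C \<Longrightarrow> X \<subseteq> C \<Longrightarrow> M \<subseteq> C \<Longrightarrow> C = M"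
    by auto
  \<comment> \<open>A chain larger than \<open>M\<close> also contains \<open>X\<close>, so
    maximality among the chains containing \<open>X\<close> is maximality among all chains.\<close>
  have "maxchain M"
    unfolding maxchain_def using M max by (metis order_trans psubset_eq)
  then show ?thesis using that M(2) by blast
qed

text \<open>Two elements of \<open>L\<close> with the same parameter are comparable, hence equal by
  rigidity; so the first branch of \<open>loewner_map\<close> applies.\<close>

lemma loewner_map_eq:
  assumes L: "chordal_loewner_family L" and f: "f \<in> L" "has_parameter f t"
  shows "loewner_map L t = f"
proof -
  have ch: "pred_on.chain \<RR> (\<prec>) L"
    using L by (simp add: chordal_loewner_family_def pred_on.maxchain_def)
  have "g = f" if "g \<in> L" "has_parameter g t" for g
  proof -
    have "g \<in> \<RR>" "f \<in> \<RR>" "(\<prec>)\<^sup>=\<^sup>= g f \<or> (\<prec>)\<^sup>=\<^sup>= f g"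
      using ch that f unfolding pred_on.chain_def by blast+
    then show ?thesis
      using subordinate_has_parameter_eq that f by auto
  qed
  then have "\<exists>!f. f \<in> L \<and> has_parameter f t" "(THE f. f \<in> L \<and> has_parameter f t) = f"
    using f by blast+
  then show ?thesis by (simp add: loewner_map_def)
qed

section \<open>The reciprocal Cauchy transform\<close>

context real_distribution
begin

lemma integrable_cauchy_kernel:
  assumes "Im z > 0"
  shows "integrable M (\<lambda>x. 1 / (z - complex_of_real x))"
proof (rule integrable_const_bound)
  show "AE x in M. cmod (1 / (z - complex_of_real x)) \<le> 1 / Im z"
  proof (rule AE_I2)
    fix x
    have "Im z \<le> cmod (z - complex_of_real x)"
      using abs_Im_le_cmod[of "z - complex_of_real x"] by simp
    then show "cmod (1 / (z - complex_of_real x)) \<le> 1 / Im z"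
      using assms by (auto simp: norm_divide intro!: divide_left_mono mult_pos_pos)
  qed
qed measurable

text \<open>For real \<open>x\<close>, the squared modulus of \<open>1 / (z - x)\<close> is
  \<open>- Im (1 / (z - x)) / Im z\<close>. Integrated, this gives the sign of \<open>Im G\<close>
  and evaluates the second moment in the variance bound.\<close>

lemma integrable_cauchy_kernel_sq:
  assumes "Im z > 0"
  shows "integrable M (\<lambda>x. (cmod (1 / (z - complex_of_real x)))\<^sup>2)"
    and "Im z * expectation (\<lambda>x. (cmod (1 / (z - complex_of_real x)))\<^sup>2) = - Im (cauchy_transform M z)"
proof -
  have eq: "(cmod (1 / (z - complex_of_real x)))\<^sup>2 = - Im (1 / (z - complex_of_real x)) / Im z" for x
    using assms
    by (simp add: norm_divide power_divide Im_divide cmod_power2)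
  show "integrable M (\<lambda>x. (cmod (1 / (z - complex_of_real x)))\<^sup>2)"
    unfolding eq using integrable_cauchy_kernel[OF assms]
    by (intro integrable_divide integrable_minus integrable_Im)
  show "Im z * expectation (\<lambda>x. (cmod (1 / (z - complex_of_real x)))\<^sup>2) = - Im (cauchy_transform M z)"
    unfolding eq cauchy_transform_def
    using integral_Im[OF integrable_cauchy_kernel[OF assms]] assms by simp
qed

lemma Im_cauchy_transform_neg:
  assumes "Im z > 0"
  shows "Im (cauchy_transform M z) < 0"
proof -
  have "z - complex_of_real x \<noteq> 0" for x using assms by (auto simp: complex_eq_iff)
  then have "0 < expectation (\<lambda>x. (cmod (1 / (z - complex_of_real x)))\<^sup>2)"
    by (intro expectation_greater integrable_cauchy_kernel_sq assms) auto
  then have "0 < Im z * expectation (\<lambda>x. (cmod (1 / (z - complex_of_real x)))\<^sup>2)"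
    using assms by simp
  then show ?thesis using integrable_cauchy_kernel_sq(2)[OF assms] by simp
qed

lemma cauchy_transform_nonzero:
  "Im z > 0 \<Longrightarrow> cauchy_transform M z \<noteq> 0"
  using Im_cauchy_transform_neg[of z] by auto

text \<open>At a zero of the Cauchy transform both sides are 0, because
  \<open>1 / 0 = 0\<close>.\<close>

lemma Im_reciprocal_cauchy_transform:
  "Im (reciprocal_cauchy_transform M z)
    = (cmod (reciprocal_cauchy_transform M z))\<^sup>2 * - Im (cauchy_transform M z)"
  by (simp add: reciprocal_cauchy_transform_def norm_divide power_divide Im_divide cmod_power2)

lemma Im_reciprocal_cauchy_transform_pos:
  assumes "Im z > 0"
  shows "Im (reciprocal_cauchy_transform M z) > 0"
  using Im_cauchy_transform_neg[OF assms] cauchy_transform_nonzero[OF assms]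
  unfolding Im_reciprocal_cauchy_transform
  by (intro mult_pos_pos) (auto simp: reciprocal_cauchy_transform_def)

end

section \<open>Centred distributions of finite variance\<close>

locale centered_distribution = real_distribution +
  assumes integrable_sq: "integrable M (\<lambda>x. x\<^sup>2)"
    and centered: "expectation (\<lambda>x. x) = 0"
begin

lemma integrable_id: "integrable M (\<lambda>x. x)"
  by (rule square_integrable_imp_integrable[OF _ integrable_sq]) measurable

text \<open>The function \<open>v = F * u - 1\<close> has mean 0. Centring gives
  \<open>z - F = E[x v]\<close>, while \<open>Im z * E|v|^2 = Im F - Im z\<close> is at most
  \<open>|z - F|\<close>. The quantity to be bounded thus controls the second moment of
  \<open>v\<close>, and the variance is the only other input.\<close>

lemma reciprocal_cauchy_transform_bound:
  assumes z: "Im z > 0"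
  shows "cmod (reciprocal_cauchy_transform M z - z) \<le> expectation (\<lambda>x. x\<^sup>2) / Im z"
proof -
  define u where "u x = 1 / (z - complex_of_real x)" for x
  define F where "F = reciprocal_cauchy_transform M z"
  define v where "v x = F * u x - 1" for x
  define w where "w = z - F"
  have u: "integrable M u" "expectation u = cauchy_transform M z"
    using integrable_cauchy_kernel[OF z] by (simp_all add: u_def[abs_def] cauchy_transform_def)
  have FG: "F * cauchy_transform M z = 1"
    using cauchy_transform_nonzero[OF z] by (simp add: F_def reciprocal_cauchy_transform_def)
  have "z - complex_of_real x \<noteq> 0" for x using z by (auto simp: complex_eq_iff)
  then have xu: "of_real x * u x = z * u x - 1" for x by (simp add: u_def field_simps)
  have xv_eq: "of_real x * v x = F * (z * u x - 1) - of_real x" for x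
    unfolding xu[symmetric] by (simp add: v_def algebra_simps)
  have xv: "integrable M (\<lambda>x. of_real x * v x)"
    unfolding xv_eq using u integrable_id by auto
  have w_eq: "w = expectation (\<lambda>x. of_real x * v x)"
  proof -
    have "expectation (\<lambda>x. of_real x * v x) = F * (z * cauchy_transform M z - 1)"
      unfolding xv_eq using u integrable_id centered prob_space by simp
    also have "\<dots> = z * (F * cauchy_transform M z) - F" by (simp add: algebra_simps)
    finally show ?thesis using FG by (simp add: w_def)
  qed
  \<comment> \<open>The cross term of \<open>|F u - 1|^2\<close>; its mean is 1 because
    \<open>F * G = 1\<close>.\<close>
  define r where "r x = Re (F * u x)" for x
  have vv_eq: "(cmod (v x))\<^sup>2 = (cmod F)\<^sup>2 * (cmod (u x))\<^sup>2 - 2 * r x + 1" for x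
    unfolding v_def r_def power_mult_distrib[symmetric] norm_mult[symmetric]
    unfolding cmod_power2 by (simp add: power2_eq_square algebra_simps)
  have uu: "integrable M (\<lambda>x. (cmod (u x))\<^sup>2)"
    and uu_eq: "Im z * expectation (\<lambda>x. (cmod (u x))\<^sup>2) = - Im (cauchy_transform M z)"
    using integrable_cauchy_kernel_sq[OF z] by (simp_all add: u_def)
  have Fu: "integrable M r" "expectation r = 1"
  proof -
    have "integrable M (\<lambda>x. F * u x)" using u(1) by simp
    moreover have "expectation (\<lambda>x. F * u x) = 1" using u(2) FG by simp
    ultimately show "integrable M r" "expectation r = 1"
      unfolding r_def[abs_def] by (auto simp only: integrable_Re integral_Re one_complex.sel)
  qed
  have vv: "integrable M (\<lambda>x. (cmod (v x))\<^sup>2)"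
    unfolding vv_eq using uu Fu by auto
  have "Im z * expectation (\<lambda>x. (cmod (v x))\<^sup>2)
      = (cmod F)\<^sup>2 * (Im z * expectation (\<lambda>x. (cmod (u x))\<^sup>2)) - Im z"
    unfolding vv_eq using uu Fu prob_space by (simp add: algebra_simps)
  also have "\<dots> = - Im w"
    using Im_reciprocal_cauchy_transform[of z] by (simp add: uu_eq w_def F_def)
  also have "\<dots> \<le> cmod w" using abs_Im_le_cmod[of w] by linarith
  finally have V: "Im z * expectation (\<lambda>x. (cmod (v x))\<^sup>2) \<le> cmod w" .
  \<comment> \<open>AM-GM with weight \<open>Im z\<close>; the term in \<open>v\<close> is absorbed into the left-hand side by \<open>V\<close>.\<close>
  have amgm: "2 * cmod (of_real x * v x) \<le> x\<^sup>2 / Im z + Im z * (cmod (v x))\<^sup>2" for x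
  proof -
    have "0 \<le> (\<bar>x\<bar> - Im z * cmod (v x))\<^sup>2 / Im z" using z by simp
    also have "\<dots> = x\<^sup>2 / Im z + Im z * (cmod (v x))\<^sup>2 - 2 * cmod (of_real x * v x)"
      using z by (simp add: norm_mult power2_diff power_mult_distrib field_simps)
        (simp add: power2_eq_square)
    finally show ?thesis by simp
  qed
  have "2 * cmod w \<le> expectation (\<lambda>x. 2 * cmod (of_real x * v x))"
    unfolding w_eq by simp
  also have "\<dots> \<le> expectation (\<lambda>x. x\<^sup>2 / Im z + Im z * (cmod (v x))\<^sup>2)"
    using xv integrable_sq vv amgm
    by (intro integral_mono) (auto intro!: integrable_norm integrable_mult_right)
  also have "\<dots> = expectation (\<lambda>x. x\<^sup>2) / Im z + Im z * expectation (\<lambda>x. (cmod (v x))\<^sup>2)"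
    using integrable_sq vv by simp
  finally show ?thesis
    using V by (simp add: w_def F_def norm_minus_commute)
qed

text \<open>For \<open>z = iy\<close>, \<open>z * (z - F z)\<close> is the quotient of the means of
  \<open>x^2 * z / (z - x)\<close> and \<open>z / (z - x)\<close>. On the imaginary axis the kernel
  \<open>z / (z - x)\<close> is bounded by 1 and tends to 1, so dominated convergence gives the
  second moment over 1.\<close>

lemma reciprocal_cauchy_transform_has_parameter:
  "has_parameter (reciprocal_cauchy_transform M) (expectation (\<lambda>x. x\<^sup>2))"
proof -
  let ?k = "\<lambda>y x. \<i> * of_real y / (\<i> * of_real y - complex_of_real x)"
  have k_lim: "((\<lambda>y. ?k y x) \<longlongrightarrow> 1) at_top" for x
  proof -
    have "((\<lambda>y. \<i> / (\<i> - of_real x * complex_of_real (1 / y))) \<longlongrightarrow> \<i> / (\<i> - of_real x * 0)) at_top"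
      by (intro tendsto_intros tendsto_of_real_inverse_at_top) auto
    moreover have "\<forall>\<^sub>F y in at_top. \<i> / (\<i> - of_real x * complex_of_real (1 / y)) = ?k y x"
      using eventually_gt_at_top[of 0] by eventually_elim (auto simp: field_simps)
    ultimately show ?thesis by (auto intro: Lim_transform_eventually)
  qed
  have k_bound: "cmod (?k y x) \<le> 1" if "y > 0" for y x
  proof -
    have "y \<le> cmod (\<i> * of_real y - complex_of_real x)"
      using abs_Im_le_cmod[of "\<i> * of_real y - complex_of_real x"] that by simp
    then show ?thesis using that by (simp add: norm_divide norm_mult)
  qed
  have den: "((\<lambda>y. expectation (?k y)) \<longlongrightarrow> expectation (\<lambda>x. 1 :: complex)) at_top"
  proof (rule integral_dominated_convergence_at_top[where w = "\<lambda>x. 1"])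
    show "\<forall>\<^sub>F y in at_top. AE x in M. cmod (?k y x) \<le> 1"
      using eventually_gt_at_top[of 0] by eventually_elim (use k_bound in auto)
    show "AE x in M. ((\<lambda>y. ?k y x) \<longlongrightarrow> 1) at_top" using k_lim by simp
  qed auto
  have num: "((\<lambda>y. expectation (\<lambda>x. of_real (x\<^sup>2) * ?k y x))
      \<longlongrightarrow> expectation (\<lambda>x. of_real (x\<^sup>2) * 1 :: complex)) at_top"
  proof (rule integral_dominated_convergence_at_top[where w = "\<lambda>x. x\<^sup>2"])
    show "\<forall>\<^sub>F y in at_top. AE x in M. cmod (of_real (x\<^sup>2) * ?k y x) \<le> x\<^sup>2"
      using eventually_gt_at_top[of 0]
    proof eventually_elim
      case (elim y)
      then have "cmod (of_real (x\<^sup>2) * ?k y x) \<le> x\<^sup>2 * 1" for x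
        unfolding norm_mult[of "of_real (x\<^sup>2)"] by (intro mult_mono k_bound) (auto simp: norm_power)
      then show ?case by simp
    qed
    show "AE x in M. ((\<lambda>y. of_real (x\<^sup>2) * ?k y x) \<longlongrightarrow> of_real (x\<^sup>2) * 1) at_top"
      using k_lim by (intro AE_I2 tendsto_mult tendsto_const)
  qed (use integrable_sq in auto)
  have lim: "((\<lambda>y. expectation (\<lambda>x. of_real (x\<^sup>2) * ?k y x) / expectation (?k y))
      \<longlongrightarrow> of_real (expectation (\<lambda>x. x\<^sup>2))) at_top"
  proof -
    have "expectation (\<lambda>x. complex_of_real (x\<^sup>2) * 1) = of_real (expectation (\<lambda>x. x\<^sup>2))"
      unfolding mult_1_right by (rule integral_complex_of_real)
    moreover have "expectation (\<lambda>x. 1 :: complex) = 1" using prob_space by simp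
    ultimately show ?thesis using tendsto_divide[OF num den] by (simp only: div_by_1) simp
  qed
  show ?thesis
    unfolding has_parameter_def
  proof (rule Lim_transform_eventually[OF lim])
    show "\<forall>\<^sub>F y in at_top. expectation (\<lambda>x. of_real (x\<^sup>2) * ?k y x) / expectation (?k y)
      = \<i> * of_real y * (\<i> * of_real y - reciprocal_cauchy_transform M (\<i> * of_real y))"
      using eventually_gt_at_top[of 0]
    proof eventually_elim
      case (elim y)
      define z where "z = \<i> * complex_of_real y"
      have z: "Im z > 0" "z \<noteq> 0" using elim by (auto simp: z_def)
      define G where "G = cauchy_transform M z"
      have G: "G \<noteq> 0" using cauchy_transform_nonzero z by (simp add: G_def)
      define u where "u x = 1 / (z - complex_of_real x)" for x
      have u: "integrable M u" "expectation u = G"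
        using integrable_cauchy_kernel[OF z(1)] by (simp_all add: G_def cauchy_transform_def u_def[abs_def])
      \<comment> \<open>Polynomial division in \<open>x\<close> reduces the numerator to the Cauchy
        kernel plus a linear term, which integrates to 0 by centring.\<close>
      have "z - complex_of_real x \<noteq> 0" for x using z by (auto simp: complex_eq_iff)
      then have eq: "of_real (x\<^sup>2) * (z / (z - of_real x)) = z\<^sup>2 * (z * u x - 1) - z * of_real x" for x
        by (simp add: u_def field_simps power2_eq_square)
      have "expectation (\<lambda>x. of_real (x\<^sup>2) * (z / (z - of_real x))) = z\<^sup>2 * (z * G - 1)"
        unfolding eq using u integrable_id centered prob_space by simp
      moreover have "expectation (\<lambda>x. z / (z - of_real x)) = z * G"
      proof -
        have "z / (z - of_real x) = z * u x" for x by (simp add: u_def)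
        then show ?thesis using u(2) by simp
      qed
      moreover have "z\<^sup>2 * (z * G - 1) / (z * G) = z * (z - 1 / G)"
        using z G by (simp add: field_simps power2_eq_square)
      ultimately show ?case
        unfolding z_def[symmetric] by (simp add: reciprocal_cauchy_transform_def G_def)
    qed
  qed
qed

lemma restrict_reciprocal_cauchy_transform_in_class_R:
  assumes "reciprocal_cauchy_transform M univalent_on \<H>"
  shows "restrict (reciprocal_cauchy_transform M) \<H> \<in> \<RR>"
proof -
  let ?F = "reciprocal_cauchy_transform M"
  have "restrict ?F \<H> analytic_on \<H>"
  proof -
    have "?F holomorphic_on \<H>"
      using assms open_upper_half_plane by (simp add: univalent_on_def analytic_on_open)
    then have "restrict ?F \<H> holomorphic_on \<H>"
      by (rule holomorphic_transform) simp
    then show ?thesis using open_upper_half_plane by (simp add: analytic_on_open)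
  qed
  moreover have "inj_on (restrict ?F \<H>) \<H>"
    using assms by (simp add: univalent_on_def inj_on_def)
  moreover have "\<exists>C\<ge>0. \<forall>z\<in>\<H>. cmod (restrict ?F \<H> z - z) \<le> C / Im z"
    using reciprocal_cauchy_transform_bound
    by (intro exI[of _ "expectation (\<lambda>x. x\<^sup>2)"]) simp
  ultimately show ?thesis
    using Im_reciprocal_cauchy_transform_pos
    by (auto simp: class_R_def univalent_on_def)
qed

end

section \<open>Univalence and embedding into a Loewner family\<close>

theorem theorem3p1:
  fixes \<mu> :: "real measure" and \<sigma> :: real
  assumes "real_distribution \<mu>"
    and "integrable \<mu> (\<lambda>x. x\<^sup>2)"
    and "prob_space.expectation \<mu> (\<lambda>x. x) = 0"
    and "prob_space.variance \<mu> (\<lambda>x. x) = \<sigma>\<^sup>2"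
  shows "reciprocal_cauchy_transform \<mu> univalent_on \<H> \<longleftrightarrow>
    (\<exists>L. chordal_loewner_family L \<and>
      (\<forall>z\<in>\<H>. reciprocal_cauchy_transform \<mu> z = loewner_map L (\<sigma>\<^sup>2) z))"
proof -
  interpret centered_distribution \<mu>
    using assms by (intro centered_distribution.intro centered_distribution_axioms.intro)
  let ?F = "reciprocal_cauchy_transform \<mu>"
  have var: "expectation (\<lambda>x. x\<^sup>2) = \<sigma>\<^sup>2" using assms(3,4) by simp
  show ?thesis
  proof
    assume uni: "?F univalent_on \<H>"
    define f where "f = restrict ?F \<H>"
    have f: "f \<in> \<RR>"
      using restrict_reciprocal_cauchy_transform_in_class_R[OF uni] by (simp add: f_def)
    have f_par: "has_parameter f (\<sigma>\<^sup>2)"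
      using reciprocal_cauchy_transform_has_parameter unfolding has_parameter_def var
    proof (rule Lim_transform_eventually)
      show "\<forall>\<^sub>F y in at_top. \<i> * complex_of_real y * (\<i> * complex_of_real y - ?F (\<i> * complex_of_real y))
          = \<i> * complex_of_real y * (\<i> * complex_of_real y - f (\<i> * complex_of_real y))"
        using eventually_gt_at_top[of 0] by eventually_elim (simp add: f_def)
    qed
    \<comment> \<open>Chains are compared by the reflexive closure of \<open>\<prec>\<close>, so a
      singleton is a chain.\<close>
    have "pred_on.chain \<RR> (\<prec>) {f}" using f by (simp add: pred_on.chain_def)
    then obtain L where "pred_on.maxchain \<RR> (\<prec>) L" "{f} \<subseteq> L"
      by (rule pred_on.chain_extends_to_maxchain)
    then have "chordal_loewner_family L" "f \<in> L" by (auto simp: chordal_loewner_family_def)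
    then show "\<exists>L. chordal_loewner_family L \<and> (\<forall>z\<in>\<H>. ?F z = loewner_map L (\<sigma>\<^sup>2) z)"
      using loewner_map_eq[of L f] f_par by (auto simp: f_def)
  next
    assume "\<exists>L. chordal_loewner_family L \<and> (\<forall>z\<in>\<H>. ?F z = loewner_map L (\<sigma>\<^sup>2) z)"
    then obtain L where L: "chordal_loewner_family L"
      and eq: "\<And>z. z \<in> \<H> \<Longrightarrow> ?F z = loewner_map L (\<sigma>\<^sup>2) z" by blast
    \<comment> \<open>The default branch of \<open>loewner_map\<close> is the zero function, whereas
      \<open>?F \<i>\<close> has positive imaginary part. The assumed equation itself therefore
      yields the unique element of \<open>L\<close> with parameter
      \<open>\<sigma>\<^sup>2\<close>.\<close>
    have "loewner_map L (\<sigma>\<^sup>2) \<i> \<noteq> 0"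
      using Im_reciprocal_cauchy_transform_pos[of \<i>] eq[of \<i>] by auto
    then have ex1: "\<exists>!f. f \<in> L \<and> has_parameter f (\<sigma>\<^sup>2)"
      by (auto simp: loewner_map_def split: if_splits)
    then have "loewner_map L (\<sigma>\<^sup>2) \<in> L"
      using theI'[OF ex1] by (simp add: loewner_map_def)
    then have "loewner_map L (\<sigma>\<^sup>2) \<in> \<RR>"
      using L by (auto simp: chordal_loewner_family_def pred_on.maxchain_def pred_on.chain_def)
    then have "loewner_map L (\<sigma>\<^sup>2) holomorphic_on \<H>" "inj_on (loewner_map L (\<sigma>\<^sup>2)) \<H>"
      by (rule class_R_D)+
    then have "?F holomorphic_on \<H>" "inj_on ?F \<H>"
      using eq by (auto simp: inj_on_def elim: holomorphic_transform)
    then show "?F univalent_on \<H>"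
      using open_upper_half_plane by (simp add: univalent_on_def analytic_on_open)
  qed
qed

end
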